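(* Let $F : [0,\infty) \to \mathbb{R}$ be a function, let $m$ and $n$ be positive integers, and let $d := \min\{m,n\}$. The following are equivalent. (1) $F$ preserves total non-negativity entrywise on $m \times n$ matrices. (2) $F$ preserves total non-negativity entrywise on $d \times d$ matrices. (3) $F$ is either a non-negative constant or: (a) if $d = 1$: $F(x) \geq 0$ for all $x \geq 0$; (b) if $d = 2$: $F(x) = c\,\mathbf{1}_{x>0}$ for some $c > 0$, or $F(x) = c x^\alpha$ for some $c > 0$ and some $\alpha > 0$; (c) if $d = 3$: $F(x) = c x^\alpha$ for some $c > 0$ and some $\alpha \geq 1$; (d) if $d \geq 4$: $F(x) = cx$ for some $c > 0$.
   Context: A real matrix is totally non-negative if all of its minors (determinants of square submatrices, of every size) are non-negative. For a matrix $A = (a_{ij})$ with entries in $[0,\infty)$, $F[A] := (F(a_{ij}))$. "$F$ preserves total non-negativity entrywise on $m \times n$ matrices" means that $F[A]$ is totally non-negative whenever $A$ is a totally non-negative $m \times n$ matrix. $\mathbf{1}_{x>0}$ equals $1$ for $x > 0$ and $0$ for $x = 0$. *)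

theory Defs
  imports
    Complex_Main
    "Jordan_Normal_Form.Determinant"
    "Jordan_Normal_Form.DL_Submatrix"
begin

definition totally_nonneg :: "real mat \<Rightarrow> bool" where
  "totally_nonneg A \<longleftrightarrow>
     (\<forall>I J. I \<subseteq> {..<dim_row A} \<longrightarrow> J \<subseteq> {..<dim_col A} \<longrightarrow> I \<noteq> {} \<longrightarrow> card I = card J \<longrightarrow>
        det (submatrix A I J) \<ge> 0)"

text \<open>
  A function on the half-line \<open>[0, \<infinity>)\<close> is represented by a total function on the reals. Only its
  values on \<open>[0, \<infinity>)\<close> matter below, because the entries of a totally non-negative matrix are its
  minors of size one and hence non-negative.
\<close>

definition preserves_TN :: "(real \<Rightarrow> real) \<Rightarrow> nat \<Rightarrow> nat \<Rightarrow> bool" where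
  "preserves_TN F m n \<longleftrightarrow>
     (\<forall>A \<in> carrier_mat m n. totally_nonneg A \<longrightarrow> totally_nonneg (map_mat F A))"

end

theory Submission
  imports
    Defs
    "HOL-Real_Asymp.Real_Asymp"
begin

text \<open>
  Since non-strictly increasing selections of rows and columns also yield non-negative minors,
  everything reduces to the values \<open>k \<le> d\<close> for which \<open>F\<close> keeps determinants of totally
  non-negative \<open>k \<times> k\<close> matrices non-negative.

  For \<open>k = 2\<close>, the value \<open>F x * F y\<close> is a non-decreasing function of \<open>x * y\<close>, so up to scaling \<open>F\<close> is
  multiplicative and monotone, hence constant or a power function with exponent \<open>\<alpha> \<ge> 0\<close>. The
  matrix with rows \<open>(1,1,0)\<close>, \<open>(1,2,1)\<close>, \<open>(0,1,1)\<close> forces \<open>\<alpha> \<ge> 1\<close> for \<open>k = 3\<close>. For \<open>k = 4\<close>, consider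
  entries \<open>1 + x b\<close>, where \<open>b\<close> is supported on a singular \<open>3 \<times> 3\<close> block: the terms of order
  \<open>x\<^sup>3\<close> of the determinant after applying the power vanish, and the coefficient of \<open>x\<^sup>4\<close> is
  \<open>\<alpha>\<^sup>2 (\<alpha> choose 2)\<close> times a constant which is negative for a suitable \<open>b\<close>; this excludes \<open>\<alpha> > 1\<close>.

  That powers with \<open>\<alpha> \<ge> 1\<close> work for \<open>k = 3\<close> follows from Dodgson condensation at the central entry
  \<open>e\<close>, \<open>e det A = (ae - bd)(ei - fh) - (bf - ce)(dh - eg)\<close>, after bounding each difference of powers
  by the tangent of the power function at \<open>bd\<close>, \<open>fh\<close>, \<open>bf\<close>, \<open>dh\<close>. Both products of slopes equal
  \<open>\<alpha>\<^sup>2 (bdfh) powr (\<alpha> - 1)\<close>, so the bound is a non-negative multiple of \<open>e det A\<close>.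
\<close>

section \<open>Minors along increasing index maps\<close>

lemma pick_image_strict_mono:
  fixes f :: "nat \<Rightarrow> nat"
  assumes "strict_mono_on {..<k} f" and "i < k"
  shows "pick (f ` {..<k}) i = f i"
proof -
  have inj: "inj_on f {..<k}"
    using assms(1) by (rule strict_mono_on_imp_inj_on)
  have "{a \<in> f ` {..<k}. a < f i} = f ` {..<i}"
    using assms by (auto simp: strict_mono_on_less)
  moreover have "card (f ` {..<i}) = i"
    using card_image[OF inj_on_subset[OF inj, of "{..<i}"]] assms(2) by auto
  ultimately show ?thesis
    using pick_card_in_set[of "f i" "f ` {..<k}"] assms(2) by auto
qed

text \<open>Increasing maps replace index sets because a minor of a minor then comes from composing
  maps, and \<open>pick\<close> disappears.\<close>

lemma totally_nonneg_iff_strict_mono: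
  "totally_nonneg A \<longleftrightarrow>
     (\<forall>k f g. k \<ge> 1 \<longrightarrow> strict_mono_on {..<k} f \<longrightarrow> strict_mono_on {..<k} g \<longrightarrow>
        f ` {..<k} \<subseteq> {..<dim_row A} \<longrightarrow> g ` {..<k} \<subseteq> {..<dim_col A} \<longrightarrow>
        det (mat k k (\<lambda>(i,j). A $$ (f i, g j))) \<ge> 0)" (is "?L \<longleftrightarrow> ?R")
proof
  assume L: ?L
  show ?R
  proof (intro allI impI)
    fix k :: nat and f g :: "nat \<Rightarrow> nat"
    assume k: "k \<ge> 1" and f: "strict_mono_on {..<k} f" and g: "strict_mono_on {..<k} g"
      and fr: "f ` {..<k} \<subseteq> {..<dim_row A}" and gr: "g ` {..<k} \<subseteq> {..<dim_col A}"
    define I J where "I = f ` {..<k}" and "J = g ` {..<k}"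
    have cI: "card I = k" and cJ: "card J = k"
      unfolding I_def J_def
      using card_image[OF strict_mono_on_imp_inj_on[OF f]] card_image[OF strict_mono_on_imp_inj_on[OF g]]
      by auto
    have eI: "{i. i < dim_row A \<and> i \<in> I} = I" and eJ: "{i. i < dim_col A \<and> i \<in> J} = J"
      using fr gr by (auto simp: I_def J_def)
    have "submatrix A I J = mat k k (\<lambda>(i,j). A $$ (f i, g j))"
      unfolding submatrix_def eI eJ cI cJ
      by (rule eq_matI) (auto simp: I_def J_def pick_image_strict_mono f g)
    moreover have "det (submatrix A I J) \<ge> 0"
      using L fr gr k cI cJ unfolding totally_nonneg_def I_def J_def by (metis card.empty not_one_le_zero)
    ultimately show "det (mat k k (\<lambda>(i,j). A $$ (f i, g j))) \<ge> 0" by simp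
  qed
next
  assume R: ?R
  show ?L
    unfolding totally_nonneg_def
  proof (intro allI impI)
    fix I J assume I: "I \<subseteq> {..<dim_row A}" and J: "J \<subseteq> {..<dim_col A}" and ne: "I \<noteq> {}"
      and c: "card I = card J"
    have fin: "finite I" using I finite_subset by blast
    have eI: "{i. i < dim_row A \<and> i \<in> I} = I" and eJ: "{i. i < dim_col A \<and> i \<in> J} = J"
      using I J by auto
    have "card I \<ge> 1" using fin ne by (simp add: Suc_leI card_gt_0_iff)
    moreover have "strict_mono_on {..<card I} (pick I)" "strict_mono_on {..<card I} (pick J)"
      using c by (auto intro!: strict_mono_onI pick_mono_le)
    moreover have "pick I ` {..<card I} \<subseteq> {..<dim_row A}" "pick J ` {..<card I} \<subseteq> {..<dim_col A}"
      using I J c pick_in_set_le[of _ I] pick_in_set_le[of _ J] by (simp_all add: image_subset_iff subset_eq)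
    ultimately have "det (mat (card I) (card I) (\<lambda>(i,j). A $$ (pick I i, pick J j))) \<ge> 0"
      using R by blast
    then show "det (submatrix A I J) \<ge> 0"
      unfolding submatrix_def eI eJ by (simp add: c)
  qed
qed

text \<open>A monotone map is either strictly monotone, giving an ordinary minor, or repeats a
  value; then two rows or columns coincide and the determinant is zero.\<close>

lemma totally_nonneg_mono_minor:
  assumes "totally_nonneg A" and "k \<ge> 1"
    and f: "mono_on {..<k} f" "f ` {..<k} \<subseteq> {..<dim_row A}"
    and g: "mono_on {..<k} g" "g ` {..<k} \<subseteq> {..<dim_col A}"
  shows "det (mat k k (\<lambda>(i,j). A $$ (f i, g j))) \<ge> 0" (is "det ?M \<ge> 0")
proof -
  consider "inj_on f {..<k}" "inj_on g {..<k}" | "\<not> inj_on f {..<k}" | "\<not> inj_on g {..<k}"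
    by blast
  then show ?thesis
  proof cases
    case 1
    have "strict_mono_on {..<k} f" "strict_mono_on {..<k} g"
      using 1 f(1) g(1)
      by (auto intro!: strict_mono_onI order.not_eq_order_implies_strict intro: mono_onD dest: inj_onD)
    then show ?thesis
      using assms unfolding totally_nonneg_iff_strict_mono by blast
  next
    case 2
    then obtain i j where "i < k" "j < k" "i \<noteq> j" "f i = f j" by (auto simp: inj_on_def)
    then have "det ?M = 0"
      by (intro det_identical_rows[of ?M k i j]) auto
    then show ?thesis by simp
  next
    case 3
    then obtain i j where "i < k" "j < k" "i \<noteq> j" "g i = g j" by (auto simp: inj_on_def)
    then have "det ?M = 0"
      by (intro det_identical_columns[of ?M k i j]) auto
    then show ?thesis by simp
  qed
qed

text \<open>Minors of the reindexed matrix belong to the composed maps. Weak monotonicity covers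
  both submatrices and padding by repeated rows and columns.\<close>

lemma totally_nonneg_mono_reindex:
  assumes "totally_nonneg A"
    and f: "mono_on {..<m} f" "f ` {..<m} \<subseteq> {..<dim_row A}"
    and g: "mono_on {..<n} g" "g ` {..<n} \<subseteq> {..<dim_col A}"
  shows "totally_nonneg (mat m n (\<lambda>(i,j). A $$ (f i, g j)))"
  unfolding totally_nonneg_iff_strict_mono
proof (intro allI impI)
  fix k :: nat and p q :: "nat \<Rightarrow> nat"
  let ?B = "mat m n (\<lambda>(i,j). A $$ (f i, g j))"
  assume k: "k \<ge> 1" and p: "strict_mono_on {..<k} p" and q: "strict_mono_on {..<k} q"
    and pr: "p ` {..<k} \<subseteq> {..<dim_row ?B}" and qr: "q ` {..<k} \<subseteq> {..<dim_col ?B}"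
  have "mat k k (\<lambda>(i,j). ?B $$ (p i, q j)) = mat k k (\<lambda>(i,j). A $$ ((f \<circ> p) i, (g \<circ> q) j))"
    using pr qr by (intro eq_matI) (auto simp: image_subset_iff)
  moreover have "det (mat k k (\<lambda>(i,j). A $$ ((f \<circ> p) i, (g \<circ> q) j))) \<ge> 0"
  proof (rule totally_nonneg_mono_minor[OF assms(1) k])
    show "mono_on {..<k} (f \<circ> p)"
      using f(1) pr strict_mono_on_imp_mono_on[OF p]
      by (auto simp: mono_on_def image_subset_iff)
    show "mono_on {..<k} (g \<circ> q)"
      using g(1) qr strict_mono_on_imp_mono_on[OF q]
      by (auto simp: mono_on_def image_subset_iff)
  qed (use f(2) g(2) pr qr in \<open>auto simp: image_subset_iff\<close>)
  ultimately show "det (mat k k (\<lambda>(i,j). ?B $$ (p i, q j))) \<ge> 0" by simp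
qed

lemma totally_nonneg_det:
  assumes "totally_nonneg A" and A: "A \<in> carrier_mat k k"
  shows "det A \<ge> 0"
proof (cases "k = 0")
  case True
  then show ?thesis using A by simp
next
  case False
  have "mat k k (\<lambda>(i,j). A $$ (id i, id j)) = A"
    using A by (intro eq_matI) auto
  then show ?thesis
    using totally_nonneg_mono_minor[OF assms(1), of k id id] A False
    by (auto simp: mono_on_def)
qed

section \<open>Reduction to determinants of one size\<close>

definition preserves_det_nonneg :: "(real \<Rightarrow> real) \<Rightarrow> nat \<Rightarrow> bool" where
  "preserves_det_nonneg F k \<longleftrightarrow>
     (\<forall>B\<in>carrier_mat k k. totally_nonneg B \<longrightarrow> det (map_mat F B) \<ge> 0)"

text \<open>
  A \<open>k \<times> k\<close> matrix is padded to size \<open>m \<times> n\<close> by repeating its last row and column, not by zeros: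
  nothing is known about \<open>F 0\<close>.
\<close>

lemma preserves_TN_iff_preserves_det_nonneg:
  "preserves_TN F m n \<longleftrightarrow> (\<forall>k\<in>{1..min m n}. preserves_det_nonneg F k)"
  unfolding preserves_det_nonneg_def
proof (intro iffI ballI impI)
  fix k B assume F: "preserves_TN F m n" and k: "k \<in> {1..min m n}"
    and B: "B \<in> carrier_mat k k" "totally_nonneg B"
  define C where "C = mat m n (\<lambda>(i,j). B $$ (min i (k-1), min j (k-1)))"
  have "totally_nonneg C"
    unfolding C_def using k B by (intro totally_nonneg_mono_reindex) (auto simp: mono_on_def)
  then have "totally_nonneg (map_mat F C)"
    using F by (auto simp: preserves_TN_def C_def)
  then have "det (mat k k (\<lambda>(i,j). map_mat F C $$ (id i, id j))) \<ge> 0"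
    using k by (intro totally_nonneg_mono_minor) (auto simp: mono_on_def C_def)
  also have "mat k k (\<lambda>(i,j). map_mat F C $$ (id i, id j)) = map_mat F B"
    using k B by (intro eq_matI) (auto simp: C_def)
  finally show "det (map_mat F B) \<ge> 0" .
next
  assume *: "\<forall>k\<in>{1..min m n}. \<forall>B\<in>carrier_mat k k. totally_nonneg B \<longrightarrow> det (map_mat F B) \<ge> 0"
  show "preserves_TN F m n"
    unfolding preserves_TN_def totally_nonneg_iff_strict_mono[of "map_mat F _"]
  proof (intro ballI allI impI)
    fix A :: "real mat" and k :: nat and f g :: "nat \<Rightarrow> nat"
    assume A: "A \<in> carrier_mat m n" "totally_nonneg A" and k: "k \<ge> 1"
      and f: "strict_mono_on {..<k} f" and g: "strict_mono_on {..<k} g"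
      and fr: "f ` {..<k} \<subseteq> {..<dim_row (map_mat F A)}"
      and gr: "g ` {..<k} \<subseteq> {..<dim_col (map_mat F A)}"
    have "k \<le> m" "k \<le> n"
      using card_inj_on_le[OF strict_mono_on_imp_inj_on[OF f] fr]
        card_inj_on_le[OF strict_mono_on_imp_inj_on[OF g] gr] A by auto
    moreover have "totally_nonneg (mat k k (\<lambda>(i,j). A $$ (f i, g j)))"
      using A f g fr gr
      by (intro totally_nonneg_mono_reindex) (auto dest: strict_mono_on_imp_mono_on)
    ultimately have "det (map_mat F (mat k k (\<lambda>(i,j). A $$ (f i, g j)))) \<ge> 0"
      using * k by auto
    also have "map_mat F (mat k k (\<lambda>(i,j). A $$ (f i, g j))) = mat k k (\<lambda>(i,j). map_mat F A $$ (f i, g j))"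
      using A fr gr by (intro eq_matI) (auto simp: image_subset_iff)
    finally show "det (mat k k (\<lambda>(i,j). map_mat F A $$ (f i, g j))) \<ge> 0" .
  qed
qed

section \<open>Explicit determinants up to size four\<close>

lemma cofactor_mat:
  assumes "i < Suc n" "j < Suc n"
  shows "cofactor (mat (Suc n) (Suc n) h) i j =
    (-1) ^ (i + j) * det (mat n n (\<lambda>(i',j'). h (if i' < i then i' else Suc i', if j' < j then j' else Suc j')))"
proof -
  have "mat_delete (mat (Suc n) (Suc n) h) i j =
      mat n n (\<lambda>(i',j'). h (if i' < i then i' else Suc i', if j' < j then j' else Suc j'))"
    using assms by (intro eq_matI) (auto simp: mat_delete_def)
  then show ?thesis by (simp add: cofactor_def)
qed

text \<open>The minors are again of the form \<open>mat n n\<close>, so each size feeds the formula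
  for the next.\<close>

lemma det_mat_Suc:
  fixes h :: "nat \<times> nat \<Rightarrow> 'a :: comm_ring_1"
  shows "det (mat (Suc n) (Suc n) h) =
    (\<Sum>j<Suc n. h (0, j) * ((-1) ^ j * det (mat n n (\<lambda>(i',j'). h (Suc i', if j' < j then j' else Suc j')))))"
  by (subst laplace_expansion_row[of _ "Suc n" 0]) (auto intro!: sum.cong simp: cofactor_mat)

lemma det_mat_1: "det (mat 1 1 h) = (h (0,0) :: 'a :: comm_ring_1)"
  by (subst det_single) auto

lemma det_mat_2: "det (mat 2 2 h) = (h (0,0) * h (1,1) - h (0,1) * h (1,0) :: 'a :: comm_ring_1)"
  using det_mat_Suc[of 1 h] unfolding det_mat_1 by (simp add: eval_nat_numeral algebra_simps)

lemma det_mat_3: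
  "det (mat 3 3 h) = (h (0,0) * (h (1,1) * h (2,2) - h (1,2) * h (2,1))
     - h (0,1) * (h (1,0) * h (2,2) - h (1,2) * h (2,0))
     + h (0,2) * (h (1,0) * h (2,1) - h (1,1) * h (2,0)) :: 'a :: comm_ring_1)"
  using det_mat_Suc[of 2 h] unfolding det_mat_2 by (simp add: eval_nat_numeral algebra_simps)

lemma det_mat_4:
  "det (mat 4 4 h) = (
       h (0,0) * (h (1,1) * (h (2,2) * h (3,3) - h (2,3) * h (3,2))
         - h (1,2) * (h (2,1) * h (3,3) - h (2,3) * h (3,1))
         + h (1,3) * (h (2,1) * h (3,2) - h (2,2) * h (3,1)))
     - h (0,1) * (h (1,0) * (h (2,2) * h (3,3) - h (2,3) * h (3,2))
         - h (1,2) * (h (2,0) * h (3,3) - h (2,3) * h (3,0))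
         + h (1,3) * (h (2,0) * h (3,2) - h (2,2) * h (3,0)))
     + h (0,2) * (h (1,0) * (h (2,1) * h (3,3) - h (2,3) * h (3,1))
         - h (1,1) * (h (2,0) * h (3,3) - h (2,3) * h (3,0))
         + h (1,3) * (h (2,0) * h (3,1) - h (2,1) * h (3,0)))
     - h (0,3) * (h (1,0) * (h (2,1) * h (3,2) - h (2,2) * h (3,1))
         - h (1,1) * (h (2,0) * h (3,2) - h (2,2) * h (3,0))
         + h (1,2) * (h (2,0) * h (3,1) - h (2,1) * h (3,0))) :: 'a :: comm_ring_1)"
  using det_mat_Suc[of 3 h] unfolding det_mat_3 by (simp add: eval_nat_numeral algebra_simps)

text \<open>Meant for concrete matrices: the smaller minors become polynomials over finitely many
  indices. For size 4 the only selection is the whole matrix.\<close>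

lemma totally_nonneg_matI:
  fixes h :: "nat \<times> nat \<Rightarrow> real"
  assumes n: "n \<le> 4"
    and m1: "\<And>i j. i < n \<Longrightarrow> j < n \<Longrightarrow> h (i,j) \<ge> 0"
    and m2: "\<And>i i' j j'. i < i' \<Longrightarrow> i' < n \<Longrightarrow> j < j' \<Longrightarrow> j' < n \<Longrightarrow>
      h (i,j) * h (i',j') - h (i,j') * h (i',j) \<ge> 0"
    and m3: "\<And>i i' i'' j j' j''. i < i' \<Longrightarrow> i' < i'' \<Longrightarrow> i'' < n \<Longrightarrow> j < j' \<Longrightarrow> j' < j'' \<Longrightarrow> j'' < n \<Longrightarrow>
      h (i,j) * (h (i',j') * h (i'',j'') - h (i',j'') * h (i'',j'))
      - h (i,j') * (h (i',j) * h (i'',j'') - h (i',j'') * h (i'',j))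
      + h (i,j'') * (h (i',j) * h (i'',j') - h (i',j') * h (i'',j)) \<ge> 0"
    and m4: "n = 4 \<Longrightarrow> det (mat n n h) \<ge> 0"
  shows "totally_nonneg (mat n n h)"
  unfolding totally_nonneg_iff_strict_mono
proof (intro allI impI)
  fix k :: nat and f g :: "nat \<Rightarrow> nat"
  let ?A = "mat n n h"
  assume k: "k \<ge> 1" and f: "strict_mono_on {..<k} f" and g: "strict_mono_on {..<k} g"
    and fr: "f ` {..<k} \<subseteq> {..<dim_row ?A}" and gr: "g ` {..<k} \<subseteq> {..<dim_col ?A}"
  have kn: "k \<le> n"
    using card_inj_on_le[OF strict_mono_on_imp_inj_on[OF f] fr] by auto
  have lt: "f i < f j" "g i < g j" if "i < j" "j < k" for i j
    using f g that by (auto simp: strict_mono_on_def)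
  have bd: "f i < n" "g i < n" if "i < k" for i
    using fr gr that by (auto simp: image_subset_iff)
  have eq: "mat k k (\<lambda>(i,j). ?A $$ (f i, g j)) = mat k k (\<lambda>(i,j). h (f i, g j))"
    using bd by (intro eq_matI) auto
  consider "k = 1" | "k = 2" | "k = 3" | "k = 4" using k kn n by linarith
  then show "det (mat k k (\<lambda>(i,j). ?A $$ (f i, g j))) \<ge> 0"
  proof cases
    case 1
    then show ?thesis unfolding eq using m1 bd by (simp add: det_mat_1[unfolded One_nat_def])
  next
    case 2
    then show ?thesis unfolding eq using m2[of "f 0" "f 1" "g 0" "g 1"] lt[of 0 1] bd[of 1]
      by (simp add: det_mat_2)
  next
    case 3
    then show ?thesis unfolding eq
      using m3[of "f 0" "f 1" "f 2" "g 0" "g 1" "g 2"] lt[of 0 1] lt[of 1 2] bd[of 2]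
      by (simp add: det_mat_3)
  next
    case 4
    then have n4: "n = 4" using kn n by simp
    have "f i = i \<and> g i = i" if "i < 4" for i
    proof -
      have "f 0 < f 1" "f 1 < f 2" "f 2 < f 3" "f 3 < 4" "g 0 < g 1" "g 1 < g 2" "g 2 < g 3" "g 3 < 4"
        using lt bd 4 n4 by auto
      then have "f 0 = 0 \<and> f 1 = 1 \<and> f 2 = 2 \<and> f 3 = 3" "g 0 = 0 \<and> g 1 = 1 \<and> g 2 = 2 \<and> g 3 = 3"
        by linarith+
      moreover have "i = 0 \<or> i = 1 \<or> i = 2 \<or> i = 3" using that by linarith
      ultimately show ?thesis by auto
    qed
    then have "mat k k (\<lambda>(i,j). h (f i, g j)) = mat n n h"
      using 4 n4 by (intro eq_matI) auto
    then show ?thesis unfolding eq using m4 n4 by simp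
  qed
qed

section \<open>Monotone additive and multiplicative functions\<close>

text \<open>Additivity fixes \<open>h\<close> on the integers. Monotonicity traps
  \<open>h (n * x)\<close> between neighbouring integer values, so the deviation from linearity is
  at most \<open>h 1 / n\<close> for every positive \<open>n\<close>.\<close>

lemma additive_mono_imp_linear:
  fixes h :: "real \<Rightarrow> real"
  assumes add: "\<And>x y. h (x + y) = h x + h y" and mono: "mono h"
  shows "h x = x * h 1"
proof (rule ccontr)
  assume ne: "h x \<noteq> x * h 1"
  interpret additive h by standard (rule add)
  have nat: "h (real n * y) = real n * h y" for n y
    by (induction n) (simp_all add: zero add algebra_simps)
  have int: "h (real_of_int k) = real_of_int k * h 1" for k
    by (cases k rule: int_cases2) (use nat[of _ 1] in \<open>simp_all add: minus\<close>)
  obtain n :: nat where n: "h 1 < real n * \<bar>h x - x * h 1\<bar>"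
    using reals_Archimedean3[of "\<bar>h x - x * h 1\<bar>"] ne by auto
  define k where "k = \<lfloor>real n * x\<rfloor>"
  have k: "real_of_int k \<le> real n * x" "real n * x \<le> real_of_int (k + 1)"
    unfolding k_def by linarith+
  have h1: "h 1 \<ge> 0" using monoD[OF mono, of 0 1] zero by simp
  have "real_of_int k * h 1 \<le> real n * h x" "real n * h x \<le> real_of_int (k + 1) * h 1"
    using monoD[OF mono k(1)] monoD[OF mono k(2)] unfolding nat int .
  moreover have "real_of_int k * h 1 \<le> real n * x * h 1" "real n * x * h 1 \<le> real_of_int (k + 1) * h 1"
    using k h1 by (auto intro: mult_right_mono)
  ultimately have "\<bar>real n * h x - real n * x * h 1\<bar> \<le> h 1"
    by (simp add: abs_le_iff algebra_simps)
  also have "\<bar>real n * h x - real n * x * h 1\<bar> = real n * \<bar>h x - x * h 1\<bar>"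
    by (simp add: abs_mult mult.assoc flip: right_diff_distrib)
  finally show False using n by simp
qed

text \<open>In logarithmic coordinates the function is additive and monotone; the exponent is its
  slope.\<close>

lemma multiplicative_mono_imp_powr:
  fixes g :: "real \<Rightarrow> real"
  assumes mult: "\<And>x y. x > 0 \<Longrightarrow> y > 0 \<Longrightarrow> g (x * y) = g x * g y"
    and mono: "\<And>x y. 0 < x \<Longrightarrow> x \<le> y \<Longrightarrow> g x \<le> g y"
    and pos: "\<And>x. x > 0 \<Longrightarrow> g x > 0"
  shows "\<exists>\<alpha>\<ge>0. \<forall>x>0. g x = x powr \<alpha>"
proof -
  define h where "h t = ln (g (exp t))" for t
  have "mono h"
    by (intro monoI) (auto simp: h_def pos intro!: mono)
  moreover have "h (s + t) = h s + h t" for s t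
    using pos[of "exp s"] pos[of "exp t"] by (simp add: h_def exp_add mult ln_mult)
  ultimately have lin: "h t = t * h 1" for t
    by (intro additive_mono_imp_linear)
  have "h 1 \<ge> 0"
    using monoD[OF \<open>mono h\<close>, of 0 1] lin[of 0] by simp
  moreover have "g x = x powr h 1" if "x > 0" for x
    using lin[of "ln x"] that pos[OF that]
    by (simp add: h_def[of "ln x"] powr_def mult.commute) (metis exp_ln)
  ultimately show ?thesis by blast
qed

section \<open>Test matrices and size one\<close>

lemma preserves_det_nonneg_mat:
  assumes "preserves_det_nonneg F k" and "totally_nonneg (mat k k h)"
  shows "det (mat k k (F \<circ> h)) \<ge> 0"
proof -
  have "map_mat F (mat k k h) = mat k k (F \<circ> h)"
    by (intro eq_matI) auto
  then show ?thesis
    using assms unfolding preserves_det_nonneg_def by (metis mat_carrier)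
qed

lemma preserves_det_nonneg_1_iff:
  "preserves_det_nonneg F 1 \<longleftrightarrow> (\<forall>x\<ge>0. F x \<ge> 0)"
proof
  assume F: "preserves_det_nonneg F 1"
  show "\<forall>x\<ge>0. F x \<ge> 0"
  proof (intro allI impI)
    fix x :: real assume "x \<ge> 0"
    then have "totally_nonneg (mat 1 1 (\<lambda>_. x))"
      by (intro totally_nonneg_matI) auto
    from preserves_det_nonneg_mat[OF F this] show "F x \<ge> 0"
      unfolding det_mat_1 by simp
  qed
next
  assume F: "\<forall>x\<ge>0. F x \<ge> 0"
  show "preserves_det_nonneg F 1"
    unfolding preserves_det_nonneg_def
  proof (intro ballI impI)
    fix B :: "real mat" assume B: "B \<in> carrier_mat 1 1" "totally_nonneg B"
    then show "det (map_mat F B) \<ge> 0"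
      using F totally_nonneg_det[OF B(2,1)] det_single[of B] det_single[of "map_mat F B"] by auto
  qed
qed

section \<open>Tangents of powers and determinants of size three\<close>

text \<open>Bernoulli's inequality for real exponents, from \<open>ln u \<le> u - 1\<close>.\<close>

lemma powr_above_tangent_one:
  fixes z \<alpha> :: real
  assumes "z \<ge> 0" and "\<alpha> \<ge> 1"
  shows "1 + \<alpha> * (z - 1) \<le> z powr \<alpha>"
proof (cases "z = 0 \<or> 1 + \<alpha> * (z - 1) \<le> 0")
  case True
  then show ?thesis using assms by (auto intro: order_trans)
next
  case False
  define v where "v = 1 + \<alpha> * (z - 1)"
  have z: "z > 0" and v: "v > 0" using False assms by (auto simp: v_def)
  \<comment> \<open>With this splitting the two bounds from \<open>ln u \<le> u - 1\<close> cancel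
    exactly, by the choice of \<open>v\<close>.\<close>
  have "ln v - \<alpha> * ln z = ln (v / z) + (\<alpha> - 1) * ln (1 / z)"
    using z v by (simp add: ln_div algebra_simps)
  also have "\<dots> \<le> (v / z - 1) + (\<alpha> - 1) * (1 / z - 1)"
    using z v assms by (intro add_mono mult_left_mono ln_le_minus_one) auto
  also have "\<dots> = 0"
    using z by (simp add: v_def field_simps)
  finally have "exp (ln v) \<le> exp (\<alpha> * ln z)" by simp
  then show ?thesis using z v by (simp add: powr_def flip: v_def)
qed

lemma powr_above_tangent:
  fixes x y \<alpha> :: real
  assumes "x \<ge> 0" and "y \<ge> 0" and "\<alpha> \<ge> 1"
  shows "\<alpha> * y powr (\<alpha> - 1) * (x - y) \<le> x powr \<alpha> - y powr \<alpha>"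
\<comment> \<open>For \<open>y = 0\<close> the left side is 0, because \<open>0 powr r = 0\<close>
  for every \<open>r\<close>, even for \<open>r = 0\<close>.\<close>
proof (cases "y = 0")
  case False
  then have y: "y > 0" using assms by simp
  have p: "y powr \<alpha> = y powr (\<alpha> - 1) * y"
    using y powr_add[of y "\<alpha> - 1" 1] by simp
  have "y powr \<alpha> * (1 + \<alpha> * (x / y - 1)) \<le> y powr \<alpha> * (x / y) powr \<alpha>"
    using assms y by (intro mult_left_mono powr_above_tangent_one) auto
  also have "y powr \<alpha> * (x / y) powr \<alpha> = x powr \<alpha>"
    using assms y by (simp flip: powr_mult)
  finally have "y powr \<alpha> * (1 + \<alpha> * (x / y - 1)) \<le> x powr \<alpha>" .
  moreover have "y powr \<alpha> * (\<alpha> * (x / y - 1)) = \<alpha> * y powr (\<alpha> - 1) * (x - y)"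
    using y by (simp add: p field_simps)
  ultimately show ?thesis by (simp add: distrib_left)
qed simp

lemma det3_powr_nonneg:
  fixes a b c d e f g h i \<alpha> :: real
  assumes nn: "a \<ge> 0" "b \<ge> 0" "c \<ge> 0" "d \<ge> 0" "e \<ge> 0" "f \<ge> 0" "g \<ge> 0" "h \<ge> 0" "i \<ge> 0"
    and minors: "b * d \<le> a * e" "c * e \<le> b * f" "e * g \<le> d * h" "f * h \<le> e * i"
    and det: "a * (e * i - f * h) - b * (d * i - f * g) + c * (d * h - e * g) \<ge> 0"
    and \<alpha>: "\<alpha> \<ge> 1"
  shows "a powr \<alpha> * (e powr \<alpha> * i powr \<alpha> - f powr \<alpha> * h powr \<alpha>)
    - b powr \<alpha> * (d powr \<alpha> * i powr \<alpha> - f powr \<alpha> * g powr \<alpha>)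
    + c powr \<alpha> * (d powr \<alpha> * h powr \<alpha> - e powr \<alpha> * g powr \<alpha>) \<ge> 0" (is "?D \<ge> 0")
proof (cases "e = 0")
  case True
  \<comment> \<open>Condensation divides by \<open>e\<close>, so this case is separate. The minors
    force \<open>b * d\<close> and \<open>f * h\<close> to vanish, and only terms with a plus sign
    survive.\<close>
  then have bd: "b * d = 0" and fh: "f * h = 0"
    using nn minors by (auto intro!: order.antisym simp del: mult_eq_0_iff)
  have "?D = b powr \<alpha> * f powr \<alpha> * g powr \<alpha> + c powr \<alpha> * d powr \<alpha> * h powr \<alpha>"
    using True bd fh by (auto simp: algebra_simps)
  then show ?thesis by simp
next
  case False
  then have e: "e > 0" using nn by simp
  let ?T = "\<lambda>y x. \<alpha> * y powr (\<alpha> - 1) * (x - y)"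
  have tangent: "?T y x \<le> x powr \<alpha> - y powr \<alpha>" if "x \<ge> 0" "y \<ge> 0" for x y
    using that \<alpha> by (rule powr_above_tangent)
  have mono: "y powr \<alpha> \<le> x powr \<alpha>" if "y \<ge> 0" "y \<le> x" for x y
    using that \<alpha> by (intro powr_mono2) auto
  have "e powr \<alpha> * ?D =
      ((a * e) powr \<alpha> - (b * d) powr \<alpha>) * ((e * i) powr \<alpha> - (f * h) powr \<alpha>)
      - ((b * f) powr \<alpha> - (c * e) powr \<alpha>) * ((d * h) powr \<alpha> - (e * g) powr \<alpha>)"
    using nn by (simp add: powr_mult algebra_simps)
  \<comment> \<open>Lower bound, with tangents at the smaller products \<open>b * d\<close> and
    \<open>f * h\<close>. The minors make all factors non-negative, so the bounds can be
    multiplied.\<close>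
  moreover have "((a * e) powr \<alpha> - (b * d) powr \<alpha>) * ((e * i) powr \<alpha> - (f * h) powr \<alpha>)
      \<ge> ?T (b * d) (a * e) * ?T (f * h) (e * i)"
    using nn minors \<alpha> by (intro mult_mono tangent) (auto simp: mono)
  \<comment> \<open>Upper bound: tangency at the larger products \<open>b * f\<close> and
    \<open>d * h\<close> reverses the estimate after the change of sign.\<close>
  moreover have "((b * f) powr \<alpha> - (c * e) powr \<alpha>) * ((d * h) powr \<alpha> - (e * g) powr \<alpha>)
      \<le> (- ?T (b * f) (c * e)) * (- ?T (d * h) (e * g))"
    using nn minors \<alpha> tangent[of "c * e" "b * f"] tangent[of "e * g" "d * h"]
    by (intro mult_mono) (auto simp: mono mult_le_0_iff mult_nonneg_nonpos)
  moreover have "?T (b * d) (a * e) * ?T (f * h) (e * i) - (- ?T (b * f) (c * e)) * (- ?T (d * h) (e * g))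
      = \<alpha>\<^sup>2 * (b powr (\<alpha> - 1) * d powr (\<alpha> - 1) * f powr (\<alpha> - 1) * h powr (\<alpha> - 1)) *
        (e * (a * (e * i - f * h) - b * (d * i - f * g) + c * (d * h - e * g)))"
    using nn by (simp add: powr_mult power2_eq_square algebra_simps)
  moreover have "\<dots> \<ge> 0"
    using det e by (intro mult_nonneg_nonneg) auto
  ultimately have "e powr \<alpha> * ?D \<ge> 0" by linarith
  then show ?thesis using e by (simp add: zero_le_mult_iff)
qed

section \<open>Necessary conditions from sizes two to four\<close>

lemma powr_second_difference_tendsto:
  fixes \<alpha> b :: real
  assumes "b > 0"
  shows "((\<lambda>x. ((1 + b * x) powr \<alpha> - 1 - \<alpha> * b * x) / x\<^sup>2) \<longlongrightarrow> \<alpha> * (\<alpha> - 1) / 2 * b\<^sup>2) (at_right 0)"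
  by (rule tendsto_eq_rhs, use assms in real_asymp) (simp add: power2_eq_square)

lemma preserves_det_nonneg_2D:
  assumes F: "preserves_det_nonneg F 2"
    and "a \<ge> 0" "b \<ge> 0" "c \<ge> 0" "d \<ge> 0" "b * c \<le> a * d"
  shows "F b * F c \<le> F a * F d"
proof -
  let ?h = "\<lambda>(i,j). [[a,b],[c,d]] ! i ! j"
  have "totally_nonneg (mat 2 2 ?h)"
    using assms by (intro totally_nonneg_matI) (auto simp: less_Suc_eq numeral_eq_Suc)
  from preserves_det_nonneg_mat[OF F this] show ?thesis
    unfolding det_mat_2 by simp
qed

text \<open>Exponent 0 stays in the second case: together with \<open>F 0 = 0\<close> it gives a
  multiple of the indicator of the positive numbers.\<close>

lemma preserves_det_nonneg_2_cases:
  assumes F1: "preserves_det_nonneg F 1" and F2: "preserves_det_nonneg F 2"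
  obtains c where "c \<ge> 0" "\<forall>x\<ge>0. F x = c"
  | c \<alpha> where "c > 0" "\<alpha> \<ge> 0" "F 0 = 0" "\<forall>x>0. F x = c * x powr \<alpha>"
proof -
  note minor = preserves_det_nonneg_2D[OF F2]
  have nonneg: "F x \<ge> 0" if "x \<ge> 0" for x
    using F1 that unfolding preserves_det_nonneg_1_iff by blast
  \<comment> \<open>The matrix with diagonal \<open>x\<close>, \<open>y\<close> and antidiagonal
    \<open>x * y\<close>, 1 is singular, and so is the one with the roles exchanged; the two
    inequalities give equality.\<close>
  have mult: "F x * F y = F (x * y) * F 1" if "x \<ge> 0" "y \<ge> 0" for x y
    using that by (intro antisym minor) auto
  show thesis
  \<comment> \<open>\<open>F 1 = 0\<close> forces \<open>F y * F y = 0\<close>; otherwise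
    \<open>F 0\<close> cancels from \<open>F x * F 0 = F 0 * F 1\<close>.\<close>
  proof (cases "F 1 = 0 \<or> F 0 \<noteq> 0")
    case True
    have "F x = F 0" if "x \<ge> 0" for x
    proof (cases "F 1 = 0")
      case True
      then have "F y = 0" if "y \<ge> 0" for y using mult[OF that that] by simp
      then show ?thesis using that by simp
    next
      case False
      then have "F 0 \<noteq> 0" using True by simp
      then have "F x = F 1" "F 0 = F 1" using mult[of x 0] mult[of 0 0] that by simp_all
      then show ?thesis by simp
    qed
    then show thesis using that(1) nonneg[of 0] by blast
  next
    case False
    define g where "g x = F x / F 1" for x
    have F1pos: "F 1 > 0" using False nonneg[of 1] by simp
    have "\<exists>\<alpha>\<ge>0. \<forall>x>0. g x = x powr \<alpha>"
    proof (rule multiplicative_mono_imp_powr)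
      show "g (x * y) = g x * g y" if "x > 0" "y > 0" for x y
        using mult[of x y] that F1pos by (simp add: g_def field_simps)
      show "g x \<le> g y" if "0 < x" "x \<le> y" for x y
        using minor[of y x 1 1] that F1pos by (simp add: g_def divide_right_mono)
      \<comment> \<open>\<open>F x * F (1 / x)\<close> equals \<open>F 1 * F 1\<close>, which rules
        out \<open>F x = 0\<close>.\<close>
      show "g x > 0" if "x > 0" for x
        using mult[of x "1 / x"] nonneg[of x] that F1pos
        by (auto simp: g_def order.strict_iff_order)
    qed
    then obtain \<alpha> where "\<alpha> \<ge> 0" and \<alpha>: "\<And>x. x > 0 \<Longrightarrow> g x = x powr \<alpha>" by blast
    moreover have "F x = F 1 * x powr \<alpha>" if "x > 0" for x
      using \<alpha>[OF that] F1pos by (simp add: g_def divide_eq_eq mult.commute)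
    ultimately show thesis using that(2) F1pos False by blast
  qed
qed

lemma preserves_det_nonneg_3_imp_ge_1:
  assumes F: "preserves_det_nonneg F 3"
    and c: "c > 0" and F0: "F 0 = 0" and Fx: "\<forall>x>0. F x = c * x powr \<alpha>"
  shows "\<alpha> \<ge> 1"
proof -
  \<comment> \<open>This matrix is singular, and apart from the factor \<open>c\<close> only its
    central 2 changes, so the new determinant has the sign of
    \<open>2 powr \<alpha> - 2\<close>.\<close>
  let ?h = "\<lambda>(i,j). [[1,1,0],[1,2,1],[0,1,1]] ! i ! j :: real"
  have "totally_nonneg (mat 3 3 ?h)"
    by (intro totally_nonneg_matI) (auto simp: less_Suc_eq numeral_eq_Suc)
  from preserves_det_nonneg_mat[OF F this] have "c ^ 3 * (2 powr \<alpha> - 2) \<ge> 0"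
    unfolding det_mat_3 using F0 Fx by (simp add: power3_eq_cube algebra_simps)
  then have "(2::real) powr 1 \<le> 2 powr \<alpha>"
    using c by (simp add: zero_le_mult_iff)
  then show ?thesis by (simp only: powr_le_cancel_iff)
qed

text \<open>
  The block of \<open>b\<close> with indices 1 to 3 is \<open>w i + z i * t j\<close> with \<open>w = (7, 12, 12)\<close>, \<open>z = (1, 2, 3)\<close>,
  \<open>t = (0, 1, 2)\<close>, so it is singular. The vectors are chosen such that the determinant with columns
  \<open>1, w, z\<close> is positive, which settles the minors of size 3, while the one with columns \<open>w, z, z\<^sup>2\<close> is
  negative. The latter is a multiple of the contraction of the cofactors with the squared entries.
\<close>

lemma totally_nonneg_test_matrix:
  fixes x :: real
  assumes "x \<ge> 0"
  defines "b \<equiv> [[0,0,0,0],[0,7,8,9],[0,12,14,16],[0,12,15,18]] :: real list list"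
  shows "totally_nonneg (mat 4 4 (\<lambda>(i,j). 1 + x * b ! i ! j))"
proof (rule totally_nonneg_matI)
  show "det (mat 4 4 (\<lambda>(i,j). 1 + x * b ! i ! j)) \<ge> 0"
    unfolding det_mat_4 b_def by (simp add: algebra_simps)
qed (use assms(1) in \<open>auto simp: b_def less_Suc_eq numeral_eq_Suc algebra_simps\<close>)

text \<open>Subtracting the first row from the others clears the first column and leaves the inner
  block of \<open>y\<close>.\<close>

lemma det_one_plus_bordered:
  fixes y :: "nat \<times> nat \<Rightarrow> real"
  assumes "\<And>k. y (0,k) = 0" and "\<And>k. y (k,0) = 0"
  shows "det (mat 4 4 (\<lambda>p. c * (1 + y p))) =
    c ^ 4 * (y (1,1) * (y (2,2) * y (3,3) - y (2,3) * y (3,2))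
      - y (1,2) * (y (2,1) * y (3,3) - y (2,3) * y (3,1))
      + y (1,3) * (y (2,1) * y (3,2) - y (2,2) * y (3,1)))"
  by (simp add: det_mat_4 assms algebra_simps power4_eq_xxxx)

text \<open>The letters \<open>a\<close> to \<open>i\<close> stand for the second-order remainders
  of the nine entries. There is no \<open>x ^ 3\<close> term since the integer block is singular;
  the coefficients 12, -24, ..., 2 are its cofactors.\<close>

lemma det3_second_order_expansion:
  fixes x \<alpha> :: real
  shows "x * (\<alpha> * 7 + x * a) * (x * (\<alpha> * 14 + x * e) * (x * (\<alpha> * 18 + x * i)) - x * (\<alpha> * 16 + x * f) * (x * (\<alpha> * 15 + x * h)))
    - x * (\<alpha> * 8 + x * b) * (x * (\<alpha> * 12 + x * d) * (x * (\<alpha> * 18 + x * i)) - x * (\<alpha> * 16 + x * f) * (x * (\<alpha> * 12 + x * g)))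
    + x * (\<alpha> * 9 + x * c) * (x * (\<alpha> * 12 + x * d) * (x * (\<alpha> * 15 + x * h)) - x * (\<alpha> * 14 + x * e) * (x * (\<alpha> * 12 + x * g)))
    = x ^ 4 * (\<alpha>\<^sup>2 * (12 * a - 24 * b + 12 * c - 9 * d + 18 * e - 9 * f + 2 * g - 4 * h + 2 * i)
      + \<alpha> * x * (7 * (e * i - f * h) - 8 * (d * i - f * g) + 9 * (d * h - e * g)
        - 12 * (b * i - c * h) + 14 * (a * i - c * g) - 16 * (a * h - b * g)
        + 12 * (b * f - c * e) - 15 * (a * f - c * d) + 18 * (a * e - b * d))
      + x\<^sup>2 * (a * (e * i - f * h) - b * (d * i - f * g) + c * (d * h - e * g)))"
  by (simp add: algebra_simps eval_nat_numeral)

lemma preserves_det_nonneg_4_imp_le_1: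
  assumes F: "preserves_det_nonneg F 4"
    and c: "c > 0" and Fx: "\<forall>x>0. F x = c * x powr \<alpha>"
  shows "\<alpha> \<le> 1"
proof (rule ccontr)
  assume "\<not> \<alpha> \<le> 1"
  then have \<alpha>: "\<alpha> > 1" by simp
  define q where "q b x = ((1 + b * x) powr \<alpha> - 1 - \<alpha> * b * x) / x\<^sup>2" for b x
  \<comment> \<open>This is the bracket of \<open>det3_second_order_expansion\<close> with
    \<open>q\<close> at the block entries as remainders; it has the sign of the transformed
    determinant.\<close>
  define E where "E x = \<alpha>\<^sup>2 * (12 * q 7 x - 24 * q 8 x + 12 * q 9 x
        - 9 * q 12 x + 18 * q 14 x - 9 * q 16 x + 2 * q 12 x - 4 * q 15 x + 2 * q 18 x)
      + \<alpha> * x * (7 * (q 14 x * q 18 x - q 16 x * q 15 x) - 8 * (q 12 x * q 18 x - q 16 x * q 12 x)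
        + 9 * (q 12 x * q 15 x - q 14 x * q 12 x)
        - 12 * (q 8 x * q 18 x - q 9 x * q 15 x) + 14 * (q 7 x * q 18 x - q 9 x * q 12 x)
        - 16 * (q 7 x * q 15 x - q 8 x * q 12 x)
        + 12 * (q 8 x * q 16 x - q 9 x * q 14 x) - 15 * (q 7 x * q 16 x - q 9 x * q 12 x)
        + 18 * (q 7 x * q 14 x - q 8 x * q 12 x))
      + x\<^sup>2 * (q 7 x * (q 14 x * q 18 x - q 16 x * q 15 x) - q 8 x * (q 12 x * q 18 x - q 16 x * q 12 x)
        + q 9 x * (q 12 x * q 15 x - q 14 x * q 12 x))" for x
  define C where "C = \<alpha> * (\<alpha> - 1) / 2"
  have q_lim: "(q b \<longlongrightarrow> C * b\<^sup>2) (at_right 0)" if "b > 0" for b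
    unfolding q_def C_def using that by (rule powr_second_difference_tendsto)
  note q_lims = q_lim[of 7, simplified] q_lim[of 8, simplified] q_lim[of 9, simplified]
    q_lim[of 12, simplified] q_lim[of 14, simplified] q_lim[of 15, simplified]
    q_lim[of 16, simplified] q_lim[of 18, simplified]
  \<comment> \<open>Only the first summand survives in the limit, and -12 is the sum of the
    cofactors times the squared entries.\<close>
  have "(E \<longlongrightarrow> - 12 * \<alpha>\<^sup>2 * C) (at_right 0)"
    unfolding E_def
    by (rule tendsto_eq_rhs, (rule tendsto_intros q_lims)+) simp
  moreover have "- 12 * \<alpha>\<^sup>2 * C < 0" using \<alpha> by (simp add: C_def)
  ultimately have "eventually (\<lambda>x. E x < 0) (at_right 0)"
    by (rule order_tendstoD)
  then obtain x where x: "x > 0" and Ex: "E x < 0"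
    using eventually_happens[OF eventually_conj[OF _ eventually_at_right_less[of 0]]] by fastforce
  define b :: "real list list" where "b = [[0,0,0,0],[0,7,8,9],[0,12,14,16],[0,12,15,18]]"
  define h where "h = (\<lambda>(i,j). 1 + x * b ! i ! j)"
  \<comment> \<open>The border is set to 0 by cases because \<open>det_one_plus_bordered\<close>
    asks for it at all indices, while list access beyond the end is unspecified.\<close>
  define y where "y = (\<lambda>(i,j). if i = 0 \<or> j = 0 then 0 else x * (\<alpha> * b ! i ! j + x * q (b ! i ! j) x))"
  have "(1 + x * t) powr \<alpha> = 1 + x * (\<alpha> * t + x * q t x)" for t
    using x by (simp add: q_def field_simps power2_eq_square)
  moreover have "b ! i ! j \<ge> 0" "i = 0 \<or> j = 0 \<Longrightarrow> b ! i ! j = 0" if "i < 4" "j < 4" for i j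
    using that by (auto simp: b_def less_Suc_eq numeral_eq_Suc)
  moreover have "q 0 x = 0"
    by (simp add: q_def)
  ultimately have "F (h p) = c * (1 + y p)" if "p \<in> {..<4} \<times> {..<4}" for p
    using that x Fx by (auto simp: h_def y_def add_pos_nonneg)
  then have "mat 4 4 (F \<circ> h) = mat 4 4 (\<lambda>p. c * (1 + y p))"
    by (intro eq_matI) auto
  moreover have "totally_nonneg (mat 4 4 h)"
    unfolding h_def b_def using x by (intro totally_nonneg_test_matrix) simp
  ultimately have "det (mat 4 4 (\<lambda>p. c * (1 + y p))) \<ge> 0"
    using preserves_det_nonneg_mat[OF F, of h] by simp
  also have "det (mat 4 4 (\<lambda>p. c * (1 + y p))) =
    c ^ 4 * (y (1,1) * (y (2,2) * y (3,3) - y (2,3) * y (3,2))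
      - y (1,2) * (y (2,1) * y (3,3) - y (2,3) * y (3,1))
      + y (1,3) * (y (2,1) * y (3,2) - y (2,2) * y (3,1)))"
    by (rule det_one_plus_bordered) (auto simp: y_def)
  also have "\<dots> = c ^ 4 * (x ^ 4 * E x)"
    unfolding E_def det3_second_order_expansion[symmetric] by (simp add: y_def b_def)
  finally show False
    using c x Ex by (simp add: zero_le_mult_iff)
qed

section \<open>Sufficiency of the listed functions\<close>

lemma totally_nonneg_entry:
  assumes "totally_nonneg A" and "i < dim_row A" "j < dim_col A"
  shows "A $$ (i,j) \<ge> 0"
  using totally_nonneg_mono_minor[OF assms(1), of 1 "\<lambda>_. i" "\<lambda>_. j"] assms(2,3)
  unfolding det_mat_1 by (auto simp: mono_on_def)

lemma totally_nonneg_minor_2: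
  assumes "totally_nonneg A" and "i \<le> i'" "i' < dim_row A" and "j \<le> j'" "j' < dim_col A"
  shows "A $$ (i,j') * A $$ (i',j) \<le> A $$ (i,j) * A $$ (i',j')"
proof -
  let ?f = "\<lambda>k::nat. if k = 0 then i else i'" and ?g = "\<lambda>k::nat. if k = 0 then j else j'"
  have "det (mat 2 2 (\<lambda>(k,l). A $$ (?f k, ?g l))) \<ge> 0"
    using assms by (intro totally_nonneg_mono_minor) (auto simp: mono_on_def)
  then show ?thesis
    unfolding det_mat_2 by simp
qed

lemma preserves_det_nonneg_const:
  assumes "c \<ge> 0" and "\<forall>x\<ge>0. F x = c" and k: "k \<ge> 1"
  shows "preserves_det_nonneg F k"
  unfolding preserves_det_nonneg_def
proof (intro ballI impI)
  fix B assume B: "B \<in> carrier_mat k k" "totally_nonneg B"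
  have entry: "map_mat F B $$ (i,j) = c" if "i < k" "j < k" for i j
    using assms(2) totally_nonneg_entry[OF B(2), of i j] B(1) that by auto
  show "det (map_mat F B) \<ge> 0"
  proof (cases "k = 1")
    case True
    then show ?thesis using det_single[of "map_mat F B"] B(1) entry assms(1) by auto
  next
    case False
    have "det (map_mat F B) = 0"
      using False k B(1) entry by (intro det_identical_rows[of _ k 0 1]) (auto intro!: eq_vecI)
    then show ?thesis by simp
  qed
qed

lemma preserves_det_nonneg_linear:
  assumes "c > 0" and "\<forall>x\<ge>0. F x = c * x"
  shows "preserves_det_nonneg F k"
  unfolding preserves_det_nonneg_def
proof (intro ballI impI)
  fix B assume B: "B \<in> carrier_mat k k" "totally_nonneg B"
  then have "map_mat F B = c \<cdot>\<^sub>m B"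
    using assms(2) totally_nonneg_entry[OF B(2)] by (intro eq_matI) auto
  then show "det (map_mat F B) \<ge> 0"
    using assms(1) totally_nonneg_det[OF B(2,1)] by simp
qed

lemma preserves_det_nonneg_2I:
  assumes "\<And>a b c d. a \<ge> 0 \<Longrightarrow> b \<ge> 0 \<Longrightarrow> c \<ge> 0 \<Longrightarrow> d \<ge> 0 \<Longrightarrow> b * c \<le> a * d \<Longrightarrow>
    F b * F c \<le> F a * F d"
  shows "preserves_det_nonneg F 2"
  unfolding preserves_det_nonneg_def
proof (intro ballI impI)
  fix B assume B: "B \<in> carrier_mat 2 2" "totally_nonneg B"
  have "map_mat F B = mat 2 2 (\<lambda>(i,j). F (B $$ (i,j)))"
    using B(1) by (intro eq_matI) auto
  moreover have "F (B $$ (0,1)) * F (B $$ (1,0)) \<le> F (B $$ (0,0)) * F (B $$ (1,1))"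
    using totally_nonneg_entry[OF B(2)] totally_nonneg_minor_2[OF B(2), of 0 1 0 1] B(1)
    by (intro assms) auto
  ultimately show "det (map_mat F B) \<ge> 0"
    by (simp add: det_mat_2)
qed

lemma preserves_det_nonneg_indicator_2:
  assumes "c > 0" and F: "\<forall>x\<ge>0. F x = c * of_bool (x > 0)"
  shows "preserves_det_nonneg F 2"
proof (rule preserves_det_nonneg_2I)
  fix p q r s :: real
  assume nn: "p \<ge> 0" "q \<ge> 0" "r \<ge> 0" "s \<ge> 0" and le: "q * r \<le> p * s"
  have eq: "F x * F y = c * c * of_bool (x * y > 0)" if "x \<ge> 0" "y \<ge> 0" for x y
    using F that by (simp add: zero_less_mult_iff)
  have "c * c * of_bool (q * r > 0) \<le> c * c * of_bool (p * s > 0)"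
    using le by (intro mult_left_mono) auto
  then show "F q * F r \<le> F p * F s"
    using nn by (simp only: eq)
qed

lemma preserves_det_nonneg_powr_2:
  assumes "c > 0" "\<alpha> \<ge> 0" and F: "\<forall>x\<ge>0. F x = c * x powr \<alpha>"
  shows "preserves_det_nonneg F 2"
proof (rule preserves_det_nonneg_2I)
  fix p q r s :: real
  assume nn: "p \<ge> 0" "q \<ge> 0" "r \<ge> 0" "s \<ge> 0" and le: "q * r \<le> p * s"
  have "(q * r) powr \<alpha> \<le> (p * s) powr \<alpha>"
    using nn le assms by (intro powr_mono2) auto
  then have "c * c * (q * r) powr \<alpha> \<le> c * c * (p * s) powr \<alpha>"
    by (intro mult_left_mono) auto
  then show "F q * F r \<le> F p * F s"
    using nn F by (simp add: powr_mult mult_ac)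
qed

lemma preserves_det_nonneg_powr_3:
  assumes "c > 0" "\<alpha> \<ge> 1" and F: "\<forall>x\<ge>0. F x = c * x powr \<alpha>"
  shows "preserves_det_nonneg F 3"
  unfolding preserves_det_nonneg_def
proof (intro ballI impI)
  fix B assume B: "B \<in> carrier_mat 3 3" "totally_nonneg B"
  define h where "h = (\<lambda>p. B $$ p powr \<alpha>)"
  have entry: "B $$ (i,j) \<ge> 0" if "i < 3" "j < 3" for i j
    using totally_nonneg_entry[OF B(2)] B(1) that by auto
  have "map_mat F B = c \<cdot>\<^sub>m mat 3 3 h"
    using B(1) F entry by (intro eq_matI) (auto simp: h_def)
  then have "det (map_mat F B) = c ^ 3 * det (mat 3 3 h)"
    by simp
  moreover have "mat 3 3 (\<lambda>p. B $$ p) = B"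
    using B(1) by (intro eq_matI) auto
  then have "det (mat 3 3 (\<lambda>p. B $$ p)) \<ge> 0"
    using totally_nonneg_det[OF B(2,1)] by simp
  \<comment> \<open>The four minors of adjacent rows and columns are those containing the central
    entry, as condensation needs.\<close>
  then have "det (mat 3 3 h) \<ge> 0"
    unfolding det_mat_3 h_def
    using totally_nonneg_minor_2[OF B(2), of 0 1 0 1] totally_nonneg_minor_2[OF B(2), of 0 1 1 2]
      totally_nonneg_minor_2[OF B(2), of 1 2 0 1] totally_nonneg_minor_2[OF B(2), of 1 2 1 2] B(1)
    by (intro det3_powr_nonneg assms(2) entry) (simp_all add: mult.commute)
  ultimately show "det (map_mat F B) \<ge> 0"
    using assms(1) by simp
qed

section \<open>The characterization\<close>

lemma preserves_TN_square_imp: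
  assumes F: "preserves_TN F d d" and d: "d \<ge> 1"
  shows "(\<exists>c\<ge>0. \<forall>x\<ge>0. F x = c) \<or>
      (d = 1 \<and> (\<forall>x\<ge>0. F x \<ge> 0)) \<or>
      (d = 2 \<and> ((\<exists>c>0. \<forall>x\<ge>0. F x = c * of_bool (x > 0)) \<or>
                (\<exists>c>0. \<exists>\<alpha>>0. \<forall>x\<ge>0. F x = c * x powr \<alpha>))) \<or>
      (d = 3 \<and> (\<exists>c>0. \<exists>\<alpha>\<ge>1. \<forall>x\<ge>0. F x = c * x powr \<alpha>)) \<or>
      (d \<ge> 4 \<and> (\<exists>c>0. \<forall>x\<ge>0. F x = c * x))"
proof -
  have Fk: "preserves_det_nonneg F k" if "1 \<le> k" "k \<le> d" for k
    using F that unfolding preserves_TN_iff_preserves_det_nonneg by simp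
  show ?thesis
  proof (cases "d = 1")
    case True
    then show ?thesis using Fk[of 1] preserves_det_nonneg_1_iff by simp
  next
    case False
    then have d2: "d \<ge> 2" using d by simp
    have "preserves_det_nonneg F 1" "preserves_det_nonneg F 2"
      using Fk d2 by simp_all
    then show ?thesis
    proof (cases rule: preserves_det_nonneg_2_cases)
      case (1 c)
      then show ?thesis by blast
    next
      case pw: (2 c \<alpha>)
      \<comment> \<open>At 0 both sides vanish: \<open>0 powr \<alpha> = 0\<close> even for
        \<open>\<alpha> = 0\<close>.\<close>
      have powr: "\<forall>x\<ge>0. F x = c * x powr \<alpha>"
        using pw by (auto simp: less_eq_real_def)
      have ge: "\<alpha> \<ge> 1" if "d \<ge> 3"
        using preserves_det_nonneg_3_imp_ge_1[OF Fk[of 3] pw(1,3,4)] that by simp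
      have le: "\<alpha> \<le> 1" if "d \<ge> 4"
        using preserves_det_nonneg_4_imp_le_1[OF Fk[of 4] pw(1,4)] that by simp
      consider "d = 2" "\<alpha> = 0" | "d = 2" "\<alpha> > 0" | "d = 3" | "d \<ge> 4"
        using d2 pw(2) by linarith
      then show ?thesis
      proof cases
        case 1
        then have "\<forall>x\<ge>0. F x = c * of_bool (x > 0)"
          using pw by (auto simp: less_eq_real_def)
        then show ?thesis using 1 pw(1) by blast
      next
        case 2
        then show ?thesis using powr pw(1) by blast
      next
        case 3
        then show ?thesis using powr ge pw(1) by auto
      next
        case 4
        then have "\<alpha> = 1" using ge le by simp
        then have "\<forall>x\<ge>0. F x = c * x" using powr by simp
        then show ?thesis using 4 pw(1) by blast
      qed
    qed
  qed
qed

theorem theorem3p3: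
  fixes F :: "real \<Rightarrow> real" and m n d :: nat
  assumes "m \<ge> 1" and "n \<ge> 1" and "d = min m n"
  shows "(preserves_TN F m n \<longleftrightarrow> preserves_TN F d d) \<and>
    (preserves_TN F d d \<longleftrightarrow>
      (\<exists>c\<ge>0. \<forall>x\<ge>0. F x = c) \<or>
      (d = 1 \<and> (\<forall>x\<ge>0. F x \<ge> 0)) \<or>
      (d = 2 \<and> ((\<exists>c>0. \<forall>x\<ge>0. F x = c * of_bool (x > 0)) \<or>
                (\<exists>c>0. \<exists>\<alpha>>0. \<forall>x\<ge>0. F x = c * x powr \<alpha>))) \<or>
      (d = 3 \<and> (\<exists>c>0. \<exists>\<alpha>\<ge>1. \<forall>x\<ge>0. F x = c * x powr \<alpha>)) \<or>
      (d \<ge> 4 \<and> (\<exists>c>0. \<forall>x\<ge>0. F x = c * x)))"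
proof (intro conjI iffI)
  \<comment> \<open>The determinant criterion sees the shape only through \<open>min m n\<close>,
    which is \<open>d\<close> for both shapes.\<close>
  assume "preserves_TN F d d"
  then show "preserves_TN F m n"
    using assms(3) by (simp add: preserves_TN_iff_preserves_det_nonneg)
next
  assume "preserves_TN F m n"
  then show "preserves_TN F d d"
    using assms(3) by (simp add: preserves_TN_iff_preserves_det_nonneg)
next
  assume "preserves_TN F d d"
  then show "(\<exists>c\<ge>0. \<forall>x\<ge>0. F x = c) \<or>
      (d = 1 \<and> (\<forall>x\<ge>0. F x \<ge> 0)) \<or>
      (d = 2 \<and> ((\<exists>c>0. \<forall>x\<ge>0. F x = c * of_bool (x > 0)) \<or>
                (\<exists>c>0. \<exists>\<alpha>>0. \<forall>x\<ge>0. F x = c * x powr \<alpha>))) \<or>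
      (d = 3 \<and> (\<exists>c>0. \<exists>\<alpha>\<ge>1. \<forall>x\<ge>0. F x = c * x powr \<alpha>)) \<or>
      (d \<ge> 4 \<and> (\<exists>c>0. \<forall>x\<ge>0. F x = c * x))"
    using assms by (intro preserves_TN_square_imp) auto
next
  assume "(\<exists>c\<ge>0. \<forall>x\<ge>0. F x = c) \<or>
      (d = 1 \<and> (\<forall>x\<ge>0. F x \<ge> 0)) \<or>
      (d = 2 \<and> ((\<exists>c>0. \<forall>x\<ge>0. F x = c * of_bool (x > 0)) \<or>
                (\<exists>c>0. \<exists>\<alpha>>0. \<forall>x\<ge>0. F x = c * x powr \<alpha>))) \<or>
      (d = 3 \<and> (\<exists>c>0. \<exists>\<alpha>\<ge>1. \<forall>x\<ge>0. F x = c * x powr \<alpha>)) \<or>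
      (d \<ge> 4 \<and> (\<exists>c>0. \<forall>x\<ge>0. F x = c * x))" (is "?const \<or> ?one \<or> ?two \<or> ?three \<or> ?four")
  then have "preserves_det_nonneg F k" if k: "1 \<le> k" "k \<le> d" for k
  proof (elim disjE)
    assume ?const
    then show ?thesis using preserves_det_nonneg_const k(1) by blast
  next
    assume ?one
    then show ?thesis using preserves_det_nonneg_1_iff k by (auto simp: le_antisym)
  next
    assume two: ?two
    then have "preserves_det_nonneg F 2"
      using preserves_det_nonneg_indicator_2 preserves_det_nonneg_powr_2 by (meson less_imp_le)
    moreover have "\<forall>x\<ge>0. F x \<ge> 0"
      using two by auto
    then have "preserves_det_nonneg F 1"
      unfolding preserves_det_nonneg_1_iff .
    moreover have "k = 1 \<or> k = 2" using two k by auto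
    ultimately show ?thesis by auto
  next
    assume ?three
    then obtain c \<alpha> where d: "d = 3" and F: "c > 0" "\<alpha> \<ge> 1" "\<forall>x\<ge>0. F x = c * x powr \<alpha>"
      by auto
    have "preserves_det_nonneg F 3"
      using F by (rule preserves_det_nonneg_powr_3)
    moreover have "preserves_det_nonneg F 2"
      using F by (intro preserves_det_nonneg_powr_2[of c \<alpha>]) auto
    moreover have "preserves_det_nonneg F 1"
      unfolding preserves_det_nonneg_1_iff using F by simp
    moreover have "k = 1 \<or> k = 2 \<or> k = 3" using d k by auto
    ultimately show ?thesis by auto
  next
    assume ?four
    then show ?thesis using preserves_det_nonneg_linear by blast
  qed
  then show "preserves_TN F d d"
    by (simp add: preserves_TN_iff_preserves_det_nonneg)
qed

end
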